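(* Assume the following hypothesis: for every triple $(R,c,p)$ of positive integers $R,c$ and a prime $p>3$ with $cp-R=1$, if the real hypersurface \[F_{R,c}(x_1,\dots,x_5):=c\,x_1x_2x_3x_4x_5-R\sum_{i=1}^5\prod_{j\ne i}x_j-1=0\] has an unbounded smooth positive real component on which all coordinates are greater than $p$, and if for every prime $\ell$ the equation $F_{R,c}=0$ has a solution in $(\mathbb F_\ell^\times)^5$, then that real component contains a point whose coordinates are pairwise distinct primes, all greater than $p$. Then there are infinitely many primary pseudoperfect numbers.
   Context: A squarefree positive integer $n$ is a primary pseudoperfect number if $\frac1n+\sum_{p\mid n}\frac1p=1$, the sum running over the prime divisors of $n$. *)

theory Defs
  imports "HOL-Analysis.Analysis" "HOL-Number_Theory.Cong" "HOL-Computational_Algebra.Squarefree"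
begin

definition primary_pseudoperfect :: "nat \<Rightarrow> bool" where
  "primary_pseudoperfect n \<longleftrightarrow>
     n > 0 \<and> squarefree n \<and> 1 / real n + (\<Sum>p\<in>prime_factors n. 1 / real p) = 1"

definition hyp_poly :: "nat \<Rightarrow> nat \<Rightarrow> 'a::comm_ring_1 ^ 5 \<Rightarrow> 'a" where
  "hyp_poly R c x =
     of_nat c * (\<Prod>i\<in>UNIV. x $ i) - of_nat R * (\<Sum>i\<in>UNIV. \<Prod>j\<in>UNIV - {i}. x $ j) - 1"

(* The zero set of f is smooth at x: the differential of f does not vanish there. *)
definition smooth_at :: "(real ^ 5 \<Rightarrow> real) \<Rightarrow> real ^ 5 \<Rightarrow> bool" where
  "smooth_at f x \<longleftrightarrow> (\<exists>D. (f has_derivative D) (at x) \<and> D \<noteq> (\<lambda>_. 0))"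

(* Components are taken in the part of the real hypersurface where all coordinates exceed p,
   not in the whole real hypersurface.  If c * p - R = 1, the points of the hypersurface with
   positive coordinates form a single connected set, which also contains points having a
   coordinate below p; so no component of the whole hypersurface has all coordinates greater
   than p, and a condition on such components would be vacuous. *)
definition real_component :: "nat \<Rightarrow> nat \<Rightarrow> nat \<Rightarrow> (real ^ 5) set \<Rightarrow> bool" where
  "real_component R c p C \<longleftrightarrow>
     C \<in> components {x. hyp_poly R c x = 0 \<and> (\<forall>i. 0 < x $ i \<and> real p < x $ i)}"

(* Solvability in units of the field with l elements, stated with integer representatives. *)
definition locally_solvable :: "nat \<Rightarrow> nat \<Rightarrow> nat \<Rightarrow> bool" where
  "locally_solvable R c l \<longleftrightarrow>
     (\<exists>x :: int ^ 5. (\<forall>i. \<not> [x $ i = 0] (mod int l)) \<and> [hyp_poly R c x = 0] (mod int l))"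

definition has_prime_point :: "nat \<Rightarrow> (real ^ 5) set \<Rightarrow> bool" where
  "has_prime_point p C \<longleftrightarrow>
     (\<exists>q :: nat ^ 5. (\<forall>i. prime (q $ i) \<and> q $ i > p) \<and> (\<forall>i j. i \<noteq> j \<longrightarrow> q $ i \<noteq> q $ j) \<and>
        (\<chi> i. real (q $ i)) \<in> C)"

end

theory Submission
  imports Defs
begin

text \<open>
  Let \<open>n = m p\<close> be primary pseudoperfect with largest prime factor \<open>p\<close>, and put \<open>R = m\<close> and
  \<open>c = m - (\<Sum>q | m. m / q)\<close>. Clearing denominators, the defining equation of \<open>n\<close> becomes
  \<open>c p - R = 1\<close>, and that of \<open>m q\<^sub>1 \<cdots> q\<^sub>5\<close>, for distinct primes \<open>q\<^sub>i > p\<close>, becomes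
  \<open>F\<^sub>R\<^sub>,\<^sub>c(q) = 0\<close>. So the hypothesis turns \<open>n\<close> into a larger number of the same kind, and one
  starts from \<open>42 = 2 \<cdot> 3 \<cdot> 7\<close>.

  The hypothesis applies: \<open>(p, 1, -1, 1, -1)\<close> is an integral point of the hypersurface, which
  settles all primes other than \<open>p\<close>; modulo \<open>p\<close> one has \<open>R = -1\<close>, and the equation is linear
  in \<open>x\<^sub>1\<close> once the other coordinates are fixed as \<open>(1, 1, 1, -1)\<close> or \<open>(1, 1, 1, 2)\<close>. The curve of
  points \<open>(t, s, s, s, s)\<close> is unbounded as \<open>s\<close> decreases to \<open>4 R / c\<close>, and smoothness follows
  from Euler's identity for the two homogeneous parts of \<open>F\<^sub>R\<^sub>,\<^sub>c\<close>.
\<close>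

section \<open>Coordinate forms of the hypersurface equation\<close>

lemma UNIV_5: "(UNIV :: 5 set) = {1, 2, 3, 4, 5}"
proof -
  have "x \<in> {1, 2, 3, 4, 5}" for x :: 5
  proof (induct x)
    case (of_int z)
    then have "0 \<le> z" and "z < 5" by simp_all
    then have "z = 0 \<or> z = 1 \<or> z = 2 \<or> z = 3 \<or> z = 4" by arith
    then show ?case by auto
  qed
  then show ?thesis by auto
qed

lemma hyp_poly_expand:
  fixes x :: "'a::comm_ring_1 ^ 5"
  shows "hyp_poly R c x =
    of_nat c * (x$1 * x$2 * x$3 * x$4 * x$5)
    - of_nat R * (x$2 * x$3 * x$4 * x$5 + x$1 * x$3 * x$4 * x$5 + x$1 * x$2 * x$4 * x$5
        + x$1 * x$2 * x$3 * x$5 + x$1 * x$2 * x$3 * x$4) - 1"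
  unfolding hyp_poly_def UNIV_5 by (simp add: insert_Diff_if algebra_simps)

text \<open>Each product omitting one coordinate is the full product times a reciprocal. In this
  form the equation can be compared with the sum of \<open>1 / p\<close> defining primary
  pseudoperfect numbers.\<close>

lemma hyp_poly_nonzero:
  fixes x :: "'a::field ^ 5"
  assumes "\<And>i. x $ i \<noteq> 0"
  shows "hyp_poly R c x =
    (\<Prod>i\<in>UNIV. x $ i) * (of_nat c - of_nat R * (\<Sum>i\<in>UNIV. 1 / x $ i)) - 1"
proof -
  have "(\<Prod>j\<in>UNIV - {i}. x $ j) = (\<Prod>j\<in>UNIV. x $ j) * (1 / x $ i)" for i
    using prod.remove[of UNIV i "\<lambda>j. x $ j"] assms[of i] by (simp add: field_simps)
  then show ?thesis
    unfolding hyp_poly_def by (simp add: sum_distrib_left algebra_simps)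
qed

section \<open>Solutions in units modulo every prime\<close>

lemma locally_solvable_if:
  fixes R c p l :: nat
  assumes p: "prime p" "p > 3" and eq: "int c * int p - int R = 1" and l: "prime l"
  shows "locally_solvable R c l"
proof (cases "l = p")
  case False
  \<comment> \<open>The reciprocals of the last four coordinates cancel, so the polynomial takes the
    value \<open>c * p - R - 1\<close> here.\<close>
  define x :: "int ^ 5" where "x = (\<chi> i. if i = 1 then int p else if i = 2 \<or> i = 4 then 1 else -1)"
  have "\<not> l dvd p" using False p l primes_dvd_imp_eq by blast
  then have "\<not> [x $ i = 0] (mod int l)" for i
    using prime_gt_1_nat[OF l] by (auto simp: x_def cong_0_iff)
  moreover have "hyp_poly R c x = 0"
    using eq unfolding hyp_poly_expand by (simp add: x_def)
  ultimately show ?thesis unfolding locally_solvable_def by (intro exI[of _ x]) simp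
next
  case True
  have pi: "prime (int p)" using p by simp
  have R: "int R = int c * int p - 1" using eq by simp
  have small: "\<not> int p dvd k" if "k \<in> {-1, 1, 2, 3}" for k
    using that zdvd_imp_le[of "int p" k] p(2) by auto
  \<comment> \<open>Modulo \<open>p\<close>, where \<open>R\<close> is -1, the point
    \<open>(y, 1, 1, 1, m)\<close> lies on the hypersurface iff \<open>a * y = b\<close>. So
    \<open>y = u * b\<close> works, with \<open>u\<close> inverse to \<open>a\<close>, and it is a
    unit because \<open>b\<close> is.\<close>
  have sol: "locally_solvable R c p"
    if a: "\<not> int p dvd a" and b: "\<not> int p dvd b" and m: "m \<in> {-1, 2}"
      and ab: "b = 1 - m" "a = int c * m + 1 + 3 * m" for a b m
  proof -
    have "coprime a (int p)" using pi a prime_imp_coprime coprime_commute by blast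
    then obtain u where u: "[a * u = 1] (mod int p)" using cong_solve_coprime_int by blast
    define x :: "int ^ 5" where "x = (\<chi> i. if i = 1 then u * b else if i = 5 then m else 1)"
    have "\<not> int p dvd u"
    proof
      assume "int p dvd u"
      then have "[a * u = 0] (mod int p)" by (simp add: cong_0_iff)
      then have "[1 = 0] (mod int p)" using u cong_sym cong_trans by blast
      then show False using small[of 1] by (simp add: cong_0_iff)
    qed
    then have "\<not> int p dvd u * b" using b pi prime_dvd_mult_iff by blast
    then have units: "\<not> [x $ i = 0] (mod int p)" for i
      using small m by (auto simp: x_def cong_0_iff)
    have "hyp_poly R c x = (a * u - 1) * b - int p * int c * (m + u * b * (1 + 3 * m))"
      unfolding hyp_poly_expand by (simp add: x_def R ab algebra_simps)
    moreover have "int p dvd a * u - 1" using u by (simp add: cong_iff_dvd_diff)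
    ultimately have "[hyp_poly R c x = 0] (mod int p)"
      by (simp add: cong_0_iff mult.assoc)
    then show ?thesis unfolding locally_solvable_def using units by blast
  qed
  show ?thesis
  \<comment> \<open>The coefficient \<open>a\<close> is \<open>-(c + 2)\<close> for
    \<open>m = -1\<close> and \<open>2 * c + 7\<close> for \<open>m = 2\<close>. As
    \<open>2 * c + 7 - 2 * (c + 2) = 3\<close> and \<open>p > 3\<close>, at least one of them is a
    unit.\<close>
  proof (cases "int p dvd int c + 2")
    case True
    have "\<not> int p dvd int c * 2 + 1 + 3 * 2"
    proof
      assume "int p dvd int c * 2 + 1 + 3 * 2"
      then have "int p dvd (int c * 2 + 1 + 3 * 2) - 2 * (int c + 2)"
        using True by (intro dvd_diff dvd_mult)
      then show False using small[of 3] by simp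
    qed
    then show ?thesis using sol[of _ _ 2] small[of "-1"] \<open>l = p\<close> by simp
  next
    case False
    have "\<not> int p dvd int c * (-1) + 1 + 3 * (-1)"
      using False dvd_minus_iff[of "int p" "int c + 2"] by (simp add: algebra_simps)
    then show ?thesis using sol[of _ _ "-1"] small[of 2] \<open>l = p\<close> by simp
  qed
qed

section \<open>Smoothness and unboundedness over the reals\<close>

lemma smooth_at_hyp_poly:
  fixes x :: "real ^ 5"
  assumes zero: "hyp_poly R c x = 0" and pos: "\<And>i. 0 < x $ i"
  shows "smooth_at (hyp_poly R c) x"
proof -
  define D where "D h = real c * (\<Sum>i\<in>UNIV. h $ i * (\<Prod>j\<in>UNIV - {i}. x $ j))
     - real R * (\<Sum>i\<in>UNIV. \<Sum>k\<in>UNIV - {i}. h $ k * (\<Prod>j\<in>UNIV - {i} - {k}. x $ j))" for h :: "real ^ 5"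
  have nth: "((\<lambda>x. x $ i) has_derivative (\<lambda>h. h $ i)) (at x)" for i
    by (rule bounded_linear.has_derivative[OF bounded_linear_vec_nth]) (rule has_derivative_ident)
  have "((\<lambda>x. real c * (\<Prod>i\<in>UNIV. x $ i) - real R * (\<Sum>i\<in>UNIV. \<Prod>j\<in>UNIV - {i}. x $ j) - 1)
      has_derivative (\<lambda>h. D h - 0)) (at x)"
    unfolding D_def
    by (intro has_derivative_diff has_derivative_mult_right has_derivative_sum has_derivative_prod
        has_derivative_const nth)
  then have deriv: "(hyp_poly R c has_derivative D) (at x)"
    unfolding hyp_poly_def[abs_def] by simp
  have rm: "x $ k * (\<Prod>j\<in>A - {k}. x $ j) = (\<Prod>j\<in>A. x $ j)" if "k \<in> A" for k A
    using prod.remove[of A k "\<lambda>j. x $ j"] that by simp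
  \<comment> \<open>In direction \<open>x\<close> the differential multiplies the degree 5 part by 5
    and the degree 4 part by 4; the difference of the weights leaves one positive copy of the
    latter.\<close>
  have "D x = 5 * (hyp_poly R c x + 1) + real R * (\<Sum>i\<in>UNIV. \<Prod>j\<in>UNIV - {i}. x $ j)"
    unfolding D_def hyp_poly_def by (simp add: rm card_Diff_singleton sum_distrib_left[symmetric] algebra_simps)
  also have "\<dots> \<ge> 5"
    using zero pos by (simp add: sum_nonneg prod_nonneg less_imp_le)
  finally have "D \<noteq> (\<lambda>_. 0)" by auto
  with deriv show ?thesis unfolding smooth_at_def by blast
qed

lemma unbounded_real_component:
  fixes R c p :: nat
  assumes R: "R > 0" and p: "p > 0" and eq: "int c * int p - int R = 1"
  shows "\<exists>C. real_component R c p C \<and> \<not> bounded C"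
proof -
  define S where "S = {x :: real ^ 5. hyp_poly R c x = 0 \<and> (\<forall>i. 0 < x $ i \<and> real p < x $ i)}"
  have "int (c * p) = int (R + 1)" using eq by simp
  then have cp: "c * p = R + 1" by linarith
  then have c: "c > 0" by (cases c) auto
  have cp': "real c * real p = real R + 1"
    using arg_cong[OF cp, of real] by simp
  \<comment> \<open>The value of \<open>s\<close> at which the denominator of \<open>t\<close>
    vanishes. It exceeds \<open>p\<close> because
    \<open>c * p = R + 1 < 4 * R = c * s0\<close>.\<close>
  define s0 where "s0 = 4 * real R / real c"
  have s0c: "real c * s0 = 4 * real R" using c by (simp add: s0_def)
  have "real c * real p < real c * s0" unfolding s0c cp' using R by linarith
  then have s0p: "s0 > real p" using c by simp
  \<comment> \<open>The equation at \<open>(t, s, s, s, s)\<close> is linear in \<open>t\<close>;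
    this is its solution, with numerator and denominator divided by \<open>s ^ 4\<close>.\<close>
  define t where "t s = (real R + 1 / s ^ 4) / (real c - 4 * real R / s)" for s
  have den: "real c - 4 * real R / s > 0" if "s > s0" for s
  proof -
    have "s > 0" using that s0p p by linarith
    moreover have "4 * real R < real c * s" using that c s0c
      by (metis mult_strict_left_mono of_nat_0_less_iff)
    ultimately show ?thesis by (simp add: field_simps)
  qed
  have lim: "filterlim t at_top (at_right s0)"
    unfolding t_def
  proof (rule LIM_at_top_divide)
    show "((\<lambda>s. real R + 1 / s ^ 4) \<longlongrightarrow> real R + 1 / s0 ^ 4) (at_right s0)"
      using s0p p by (intro tendsto_intros) auto
    show "0 < real R + 1 / s0 ^ 4" using R by (intro add_pos_nonneg) auto
    have "((\<lambda>s. real c - 4 * real R / s) \<longlongrightarrow> real c - 4 * real R / s0) (at_right s0)"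
      using s0p p by (intro tendsto_intros) auto
    moreover have "real c - 4 * real R / s0 = 0" using R c by (simp add: s0_def)
    ultimately show "((\<lambda>s. real c - 4 * real R / s) \<longlongrightarrow> 0) (at_right s0)" by simp
    show "\<forall>\<^sub>F s in at_right s0. 0 < real c - 4 * real R / s"
      using den by (auto simp: eventually_at_right_field intro: exI[of _ "s0 + 1"])
  qed
  then have "\<forall>\<^sub>F s in at_right s0. t s > real p"
    by (simp add: filterlim_at_top_dense)
  \<comment> \<open>Near \<open>s0\<close> the first coordinate is large, so \<open>s1\<close> can
    be chosen to keep the whole arc in the region where all coordinates exceed \<open>p\<close>. The
    arc is connected, hence lies in a single component.\<close>
  then obtain s1 where s1: "s1 > s0" "\<And>s. s0 < s \<Longrightarrow> s < s1 \<Longrightarrow> t s > real p"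
    by (auto simp: eventually_at_right_field)
  define g where "g s = ((\<chi> i. if i = 1 then t s else s) :: real ^ 5)" for s
  have gS: "g ` {s0<..<s1} \<subseteq> S"
  proof (rule image_subsetI)
    fix s assume s: "s \<in> {s0<..<s1}"
    then have sp: "s > real p" and tp: "t s > real p" using s0p s1 by auto
    then have gp: "real p < g s $ i" for i by (simp add: g_def)
    then have gp0: "0 < g s $ i" for i using le_less_trans[OF of_nat_0_le_iff] by blast
    have s_pos: "s > 0" using sp p by linarith
    have "t s * (real c - 4 * real R / s) = real R + 1 / s ^ 4"
      using den[of s] s unfolding t_def by simp
    moreover have "real c * t s * s ^ 4 - 4 * real R * t s * s ^ 3 = s ^ 4 * (t s * (real c - 4 * real R / s))"
      using s_pos by (simp add: right_diff_distrib eval_nat_numeral)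
    ultimately have "real c * t s * s ^ 4 - 4 * real R * t s * s ^ 3 = real R * s ^ 4 + 1"
      using s_pos by (simp add: distrib_left)
    then have "hyp_poly R c (g s) = 0"
      unfolding hyp_poly_expand by (simp add: g_def eval_nat_numeral algebra_simps)
    with gp gp0 show "g s \<in> S" by (simp add: S_def)
  qed
  have "continuous_on {s0<..<s1} t"
    unfolding t_def
  proof (intro continuous_intros ballI)
    fix s assume "s \<in> {s0<..<s1}"
    then have "s > s0" by simp
    with den[of s] s0p p show "s ^ 4 \<noteq> 0" "s \<noteq> 0" "real c - 4 * real R / s \<noteq> 0" by auto
  qed
  then have "continuous_on {s0<..<s1} (\<lambda>s. if i = 1 then t s else s)" for i :: 5
    using continuous_on_id by (cases "i = 1") simp_all
  then have "continuous_on {s0<..<s1} g"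
    unfolding g_def by (rule continuous_on_vec_lambda)
  then have conn: "connected (g ` {s0<..<s1})"
    by (intro connected_continuous_image) auto
  have "g ` {s0<..<s1} \<noteq> {}" using s1 by auto
  then obtain C where C: "C \<in> components S" "g ` {s0<..<s1} \<subseteq> C"
    using exists_component_superset[OF gS _ conn] gS by blast
  have "\<not> bounded C"
  proof
    assume "bounded C"
    then obtain B where B: "\<And>x. x \<in> C \<Longrightarrow> norm x \<le> B" by (auto simp: bounded_iff)
    have "\<forall>\<^sub>F s in at_right s0. t s > B" using lim by (simp add: filterlim_at_top_dense)
    then obtain b where b: "b > s0" "\<And>s. s0 < s \<Longrightarrow> s < b \<Longrightarrow> t s > B"
      by (auto simp: eventually_at_right_field)
    obtain s where s: "s0 < s" "s < min b s1" using dense[of s0 "min b s1"] b s1 by auto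
    then have "g s \<in> C" using C(2) by auto
    then have "norm (g s) \<le> B" by (rule B)
    moreover have "\<bar>g s $ 1\<bar> \<le> norm (g s)" by (rule component_le_norm_cart)
    ultimately show False using b(2)[of s] s by (simp add: g_def)
  qed
  with C show ?thesis unfolding real_component_def S_def by blast
qed

section \<open>Products of distinct primes\<close>

lemma prime_factors_prod_primes:
  fixes A :: "nat set"
  assumes "finite A" "\<And>q. q \<in> A \<Longrightarrow> prime q"
  shows "prime_factors (\<Prod>A) = A"
proof -
  have "0 \<notin> A" using assms(2)[of 0] by auto
  then show ?thesis
    using prime_factors_prod[OF assms(1), of "\<lambda>q. q"] assms by (simp add: prime_prime_factors)
qed

lemma squarefree_prod_primes:
  fixes A :: "nat set"
  assumes "finite A" "\<And>q. q \<in> A \<Longrightarrow> prime q"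
  shows "squarefree (\<Prod>A)"
  using assms by (intro squarefree_prod_coprime) (auto intro: primes_coprime squarefree_prime)

lemma primary_pseudoperfect_prod_primes:
  fixes A :: "nat set"
  assumes "finite A" "\<And>q. q \<in> A \<Longrightarrow> prime q"
  shows "primary_pseudoperfect (\<Prod>A) \<longleftrightarrow> 1 / real (\<Prod>A) + (\<Sum>q\<in>A. 1 / real q) = 1"
proof -
  have "\<Prod>A > 0" using assms by (intro prod_pos) (auto simp: prime_gt_0_nat)
  then show ?thesis
    using prime_factors_prod_primes[OF assms] squarefree_prod_primes[OF assms]
    unfolding primary_pseudoperfect_def by simp
qed

section \<open>Replacing the largest prime factor by five larger primes\<close>

text \<open>The largest prime factor \<open>p\<close> is kept apart, since it is the prime to which
  the hypothesis gets applied; primes above it are then automatically new.\<close>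

definition extendable_numbers :: "nat set" where
  "extendable_numbers = {p * \<Prod>A | p A. finite A \<and> (\<forall>q\<in>A. prime q \<and> q < p) \<and>
     prime p \<and> p > 3 \<and> primary_pseudoperfect (p * \<Prod>A)}"

lemma extendable_numbers_unbounded:
  assumes hyp: "\<And>(R::nat) (c::nat) (p::nat) (C::(real ^ 5) set).
      \<lbrakk>R > 0; c > 0; prime p; p > 3; int c * int p - int R = 1;
       real_component R c p C; \<not> bounded C; \<forall>x\<in>C. smooth_at (hyp_poly R c) x;
       \<forall>l::nat. prime l \<longrightarrow> locally_solvable R c l\<rbrakk>
      \<Longrightarrow> has_prime_point p C"
    and n: "n \<in> extendable_numbers"
  shows "\<exists>n'\<in>extendable_numbers. n < n'"
proof -
  obtain p A where n_eq: "n = p * \<Prod>A" and fin: "finite A" and small: "\<forall>q\<in>A. prime q \<and> q < p"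
    and p: "prime p" "p > 3" and pp: "primary_pseudoperfect (p * \<Prod>A)"
    using n unfolding extendable_numbers_def by blast
  have A: "finite A" "\<And>q. q \<in> A \<Longrightarrow> prime q \<and> q < p" using fin small by auto
  define m where "m = \<Prod>A"
  define S where "S = (\<Sum>q\<in>A. m div q)"
  have m: "m > 0" unfolding m_def using A by (intro prod_pos) (auto simp: prime_gt_0_nat)
  have p0: "p > 0" using p by simp
  have pA: "p \<notin> A" using A by auto
  have "real (m div q) = real m * (1 / real q)" if "q \<in> A" for q
  proof -
    have "q dvd m" unfolding m_def using A that by (intro dvd_prodI) auto
    then show ?thesis by (simp add: real_of_nat_div)
  qed
  then have S: "real S = real m * (\<Sum>q\<in>A. 1 / real q)"
    unfolding S_def by (simp add: sum_distrib_left)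
  have "primary_pseudoperfect (\<Prod>(insert p A))" using pp A pA by simp
  then have "1 / real (\<Prod>(insert p A)) + (\<Sum>q\<in>insert p A. 1 / real q) = 1"
    by (subst (asm) primary_pseudoperfect_prod_primes) (use A p in auto)
  then have "1 / (real p * real m) + (1 / real p + real S / real m) = 1"
    using A(1) pA S m by (simp flip: m_def)
  then have "1 + real m + real p * real S = real p * real m"
    using p0 m by (simp add: field_simps)
  then have "real (1 + m + p * S) = real (p * m)" by simp
  then have main: "1 + m + p * S = p * m" by (simp only: of_nat_eq_iff)
  \<comment> \<open>This makes the natural subtraction in \<open>c = m - S\<close> exact and its
    result positive.\<close>
  have Sm: "S < m"
  proof (rule ccontr)
    assume "\<not> S < m"
    then have "p * m \<le> p * S" by simp
    with main show False by linarith
  qed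
  define c where "c = m - S"
  have c: "c > 0" "real c = real m - real S" "int c = int m - int S" using Sm by (auto simp: c_def)
  have "1 + int m + int p * int S = int p * int m"
    using arg_cong[OF main, of int] by simp
  then have eq: "int c * int p - int m = 1" unfolding c(3) by (simp add: algebra_simps)
  obtain C where C: "real_component m c p C" "\<not> bounded C"
    using unbounded_real_component[OF m p0 eq] by blast
  have CS: "hyp_poly m c x = 0 \<and> (\<forall>i. 0 < x $ i)" if "x \<in> C" for x
    using C(1) that in_components_subset unfolding real_component_def by blast
  have "has_prime_point p C"
  proof (rule hyp[OF m c(1) p eq C])
    show "\<forall>x\<in>C. smooth_at (hyp_poly m c) x"
      using CS by (intro ballI smooth_at_hyp_poly) auto
    show "\<forall>l. prime l \<longrightarrow> locally_solvable m c l"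
      using locally_solvable_if[OF p eq] by simp
  qed
  then obtain q :: "nat ^ 5" where q_all: "\<forall>i. prime (q $ i) \<and> q $ i > p"
      "\<forall>i j. i \<noteq> j \<longrightarrow> q $ i \<noteq> q $ j" "(\<chi> i. real (q $ i)) \<in> C"
    unfolding has_prime_point_def by (elim exE conjE)
  then have q: "\<And>i. prime (q $ i)" "\<And>i. q $ i > p" "\<And>i j. i \<noteq> j \<Longrightarrow> q $ i \<noteq> q $ j" by auto
  define Q where "Q = range (\<lambda>i. q $ i)"
  have Q: "finite Q" "Q \<noteq> {}" "\<And>r. r \<in> Q \<Longrightarrow> prime r \<and> r > p" using q by (auto simp: Q_def)
  have inj: "inj (\<lambda>i. q $ i)" using q(3) by (auto simp: inj_def)
  have AQ: "A \<inter> Q = {}" using A(2) Q(3) by (meson disjoint_iff less_asym)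
  have Q0: "\<Prod>Q > 0" using Q by (intro prod_pos) (auto simp: prime_gt_0_nat)
  have prodQ: "real (\<Prod>Q) = (\<Prod>i\<in>UNIV. real (q $ i))"
    unfolding Q_def using inj by (simp add: prod.reindex)
  have sumQ: "(\<Sum>r\<in>Q. 1 / real r) = (\<Sum>i\<in>UNIV. 1 / real (q $ i))"
    unfolding Q_def using inj by (simp add: sum.reindex)
  have "real (q $ i) \<noteq> 0" for i using q(1)[of i] by auto
  then have "real (\<Prod>Q) * (real c - real m * (\<Sum>r\<in>Q. 1 / real r)) = 1"
    using CS[OF q_all(3)] hyp_poly_nonzero[of "\<chi> i. real (q $ i)" m c]
    unfolding prodQ sumQ by simp
  then have inv: "1 / real (\<Prod>Q) = real m - real S - real m * (\<Sum>r\<in>Q. 1 / real r)"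
    using Q0 unfolding c(2) by (metis mult_zero_left nonzero_mult_div_cancel_left zero_neq_one)
  \<comment> \<open>The defining equation for the product over \<open>A\<close> and
    \<open>Q\<close>, multiplied by \<open>m\<close>; substituting \<open>inv\<close> cancels all
    terms except \<open>m\<close>.\<close>
  have "real m * (1 / (real m * real (\<Prod>Q)) + (real S / real m + (\<Sum>r\<in>Q. 1 / real r)))
      = 1 / real (\<Prod>Q) + real S + real m * (\<Sum>r\<in>Q. 1 / real r)"
    using m by (simp add: distrib_left del: of_nat_prod)
  also have "\<dots> = real m" unfolding inv by simp
  finally have "real m * (1 / (real m * real (\<Prod>Q)) + (real S / real m + (\<Sum>r\<in>Q. 1 / real r))) = real m" .
  then have "1 / (real m * real (\<Prod>Q)) + (real S / real m + (\<Sum>r\<in>Q. 1 / real r)) = 1"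
    using m by simp
  moreover have "real S / real m = (\<Sum>q\<in>A. 1 / real q)" using S m by simp
  ultimately have "1 / real (\<Prod>(A \<union> Q)) + (\<Sum>r\<in>A \<union> Q. 1 / real r) = 1"
    using A Q AQ by (simp add: prod.union_disjoint sum.union_disjoint m_def)
  then have ppQ: "primary_pseudoperfect (\<Prod>(A \<union> Q))"
    by (subst primary_pseudoperfect_prod_primes) (use A Q in auto)
  \<comment> \<open>Elements of \<open>A\<close> lie below \<open>p\<close> and those of
    \<open>Q\<close> above it, so \<open>r\<close> is the largest prime of the new number and takes
    over the role of \<open>p\<close>.\<close>
  define r where "r = Max Q"
  define B where "B = A \<union> Q - {r}"
  have r: "r \<in> Q" "\<And>k. k \<in> Q \<Longrightarrow> k \<le> r" using Q by (auto simp: r_def)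
  have rB: "r * \<Prod>B = \<Prod>(A \<union> Q)"
    unfolding B_def using prod.remove[of "A \<union> Q" r "\<lambda>x. x"] r A Q by simp
  have "k < r" if "k \<in> B" for k
  proof (cases "k \<in> Q")
    case True
    then show ?thesis using that r(2)[of k] by (simp add: B_def)
  next
    case False
    then show ?thesis using that A(2)[of k] Q(3)[OF r(1)] by (simp add: B_def)
  qed
  moreover have "prime k" if "k \<in> B" for k using that A Q by (auto simp: B_def)
  moreover have "finite B" using A Q by (simp add: B_def)
  moreover have "primary_pseudoperfect (r * \<Prod>B)" using rB ppQ by simp
  moreover have "prime r" "r > 3" using Q(3)[OF r(1)] p by auto
  ultimately have "r * \<Prod>B \<in> extendable_numbers" unfolding extendable_numbers_def by blast
  moreover have "n < r * \<Prod>B"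
  proof -
    \<comment> \<open>Although \<open>p\<close> is dropped, the single prime \<open>r\<close>
      already outweighs it.\<close>
    have "r dvd \<Prod>Q" using Q r by (intro dvd_prodI) auto
    then have "r \<le> \<Prod>Q" using Q0 by (rule dvd_imp_le)
    then have "p < \<Prod>Q" using Q(3)[OF r(1)] by simp
    then have "p * m < \<Prod>Q * m" using m by simp
    then show ?thesis
      unfolding rB n_eq using A(1) Q(1) AQ
      by (simp add: prod.union_disjoint mult.commute flip: m_def)
  qed
  ultimately show ?thesis by blast
qed

theorem mainTheorem20:
  assumes "\<And>(R::nat) (c::nat) (p::nat) (C::(real ^ 5) set).
      \<lbrakk>R > 0; c > 0; prime p; p > 3; int c * int p - int R = 1;
       real_component R c p C; \<not> bounded C; \<forall>x\<in>C. smooth_at (hyp_poly R c) x;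
       \<forall>l::nat. prime l \<longrightarrow> locally_solvable R c l\<rbrakk>
      \<Longrightarrow> has_prime_point p C"
  shows "infinite {n. primary_pseudoperfect n}"
proof -
  have p7: "prime (7::nat)" by simp
  have "primary_pseudoperfect (\<Prod>{2, 3, 7::nat})"
    by (subst primary_pseudoperfect_prod_primes) (auto simp: p7)
  \<comment> \<open>The smaller examples 2 and 6 cannot serve as a start, since their largest primes
    violate \<open>p > 3\<close>.\<close>
  then have "7 * \<Prod>{2, 3::nat} \<in> extendable_numbers"
    unfolding extendable_numbers_def
    by (intro CollectI exI[of _ 7] exI[of _ "{2, 3}"]) (simp add: p7)
  moreover have "\<exists>n'\<in>extendable_numbers. n < n'" if "n \<in> extendable_numbers" for n
    by (rule extendable_numbers_unbounded[OF _ that]) (rule assms)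
  ultimately have "infinite extendable_numbers" using infinite_growing by blast
  moreover have "extendable_numbers \<subseteq> {n. primary_pseudoperfect n}"
    by (auto simp: extendable_numbers_def)
  ultimately show ?thesis using infinite_super by blast
qed

end
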